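(* Let $f\colon X\to\mathbb{R}$ be a continuous function on a topological space. Then $f$ is $\mathcal{H}^\bullet$-tame if and only if the functor $h(f)\colon\mathbb{M}^\circ\to\mathrm{Vect}_K$ is pointwise finite-dimensional.
   Context: Strip. $\mathbb{M}=\{(x,y)\in\mathbb{R}^2:-\pi\le x+y\le\pi\}$, ordered by $(x,y)\preceq(x',y')$ iff $x\ge x'$ and $y\le y'$. $T(x,y)=(-\pi-y,\pi-x)$ is an automorphism of $\mathbb{M}$. $D=\{(x,y)\in\mathbb{M}:0\le x-y<2\pi\}$ is a fundamental domain for $\langle T\rangle\cong\mathbb{Z}$. For $u=(x,y)\in\mathbb{M}$ put $\rho_1(u)=\{t\in\mathbb{R}:-\pi-y<\arctan t<\pi-x\}$, $\rho_0(u)=\{t\in\mathbb{R}:\arctan t<y\text{ or }\arctan t>x\}$ and $\rho(u)=(\rho_1(u),\rho_0(u))$, a pair of open subsets of $\mathbb{R}$ with $\rho_0(u)\subseteq\rho_1(u)$. $K$ is a field and $\mathcal{H}^\bullet$ is a cohomology theory on pairs of spaces with values in $\mathbb{Z}$-graded $K$-vector spaces, sending weak equivalences to isomorphisms. A continuous $f$ is $\mathcal{H}^\bullet$-tame if $\dim_K\mathcal{H}^n(f^{-1}(I))<\infty$ for every $n\in\mathbb{Z}$ and every open interval $I\subseteq\mathbb{R}$ (bounded or unbounded). The functor $h(f)$. With $f^{-1}(U,V)=(f^{-1}(U),f^{-1}(V))$, the contravariant functor $h(f)\colon\mathbb{M}^\circ\to\mathrm{Vect}_K$ is: $h(f)(u)=\mathcal{H}^n(f^{-1}(\rho(T^n(u))))$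 for $u\in T^{-n}(D)$. For $u\preceq v$ the internal map $h(f)(u\preceq v)\colon h(f)(v)\to h(f)(u)$ is: the map induced by inclusion if $u,v\in T^{-n}(D)$ for some $n$; if $u\in T^{-n}(D)$, $v\in T^{-n+1}(D)$ and $v\preceq T(u)$, put $p=T^{n-1}(v)=(x,y)$ and $w=T^n(u)=(x',y')$, so that the rectangle with lower right corner $p$, upper left corner $w$, lower left corner $v_1=(x',y)$ and upper right corner $v_2=(x,y')$ lies in $D$ and $\rho(v_1)\cup\rho(v_2)=\rho(w)$, $\rho(v_1)\cap\rho(v_2)=\rho(p)$ componentwise; the internal map is then the differential $\mathcal{H}^{n-1}(f^{-1}(\rho(p)))\to\mathcal{H}^n(f^{-1}(\rho(w)))$ of the relative Mayer–Vietoris sequence of the pairs $f^{-1}(\rho(v_1)),f^{-1}(\rho(v_2))$ (one fixed sign convention); in all other cases it is $0$. Pointwise finite-dimensional means that $h(f)(u)$ is finite-dimensional for every $u\in\mathbb{M}$. *)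

theory Defs
  imports "HOL-Analysis.Analysis" "Jordan_Normal_Form.Missing_VectorSpace"
begin

section \<open>Weak equivalences\<close>

definition cube :: "nat \<Rightarrow> (nat \<Rightarrow> real) topology" where
  "cube n = product_topology (\<lambda>_. top_of_set {0..1}) {..<n}"

definition cube_boundary :: "nat \<Rightarrow> (nat \<Rightarrow> real) set" where
  "cube_boundary n = {t \<in> topspace (cube n). \<exists>i<n. t i = 0 \<or> t i = 1}"

definition based_maps :: "nat \<Rightarrow> 'u topology \<Rightarrow> 'u \<Rightarrow> ((nat \<Rightarrow> real) \<Rightarrow> 'u) set" where
  "based_maps n X x = {g. continuous_map (cube n) X g \<and> g ` cube_boundary n \<subseteq> {x}}"

definition based_homotopic ::
  "nat \<Rightarrow> 'u topology \<Rightarrow> 'u \<Rightarrow> (((nat \<Rightarrow> real) \<Rightarrow> 'u) \<times> ((nat \<Rightarrow> real) \<Rightarrow> 'u)) set" where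
  "based_homotopic n X x =
     {(g, k). homotopic_with (\<lambda>q. q ` cube_boundary n \<subseteq> {x}) (cube n) X g k}"

text \<open>The underlying set of the homotopy group. Bijectivity of the induced maps is all that is
  needed below, since these maps are homomorphisms automatically.\<close>

definition homotopy_classes ::
  "nat \<Rightarrow> 'u topology \<Rightarrow> 'u \<Rightarrow> ((nat \<Rightarrow> real) \<Rightarrow> 'u) set set" where
  "homotopy_classes n X x = based_maps n X x // based_homotopic n X x"

definition weak_equivalence :: "'u topology \<Rightarrow> 'w topology \<Rightarrow> ('u \<Rightarrow> 'w) \<Rightarrow> bool" where
  "weak_equivalence X Y \<phi> \<longleftrightarrow>
     continuous_map X Y \<phi> \<and>
     bij_betw (\<lambda>C. \<Union>x\<in>C. path_component_of_set Y (\<phi> x))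
       (path_components_of X) (path_components_of Y) \<and>
     (\<forall>x\<in>topspace X. \<forall>n\<ge>1.
        bij_betw (\<lambda>c. based_homotopic n Y (\<phi> x) `` ((\<lambda>g. \<phi> \<circ> g) ` c))
          (homotopy_classes n X x) (homotopy_classes n Y (\<phi> x)))"


section \<open>Cohomology theories on pairs of spaces\<close>

text \<open>A theory is defined on all pairs of spaces whose points are of type \<open>'u\<close>, a stand-in for
  the universe of sets. \<open>coh E n X A\<close> is the cohomology of the pair \<open>(X, A)\<close> in degree \<open>n\<close>,
  \<open>induced E n X A Y B \<phi>\<close> is the map from \<open>coh E n Y B\<close> to \<open>coh E n X A\<close> induced by
  \<open>\<phi>\<close>, and \<open>conn E n X A\<close> is the connecting homomorphism from \<open>coh E n A {}\<close> to
  \<open>coh E (n + 1) X A\<close>, where a subset \<open>A\<close> of \<open>X\<close>, as a space, is \<open>subtopology X A\<close>.\<close>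

record ('u, 'k, 'v) cohomology_data =
  coh :: "int \<Rightarrow> 'u topology \<Rightarrow> 'u set \<Rightarrow> ('k, 'v) module"
  induced :: "int \<Rightarrow> 'u topology \<Rightarrow> 'u set \<Rightarrow> 'u topology \<Rightarrow> 'u set \<Rightarrow> ('u \<Rightarrow> 'u) \<Rightarrow> 'v \<Rightarrow> 'v"
  conn :: "int \<Rightarrow> 'u topology \<Rightarrow> 'u set \<Rightarrow> 'v \<Rightarrow> 'v"

definition pair_map ::
  "'u topology \<Rightarrow> 'u set \<Rightarrow> 'u topology \<Rightarrow> 'u set \<Rightarrow> ('u \<Rightarrow> 'u) \<Rightarrow> bool" where
  "pair_map X A Y B \<phi> \<longleftrightarrow>
     A \<subseteq> topspace X \<and> B \<subseteq> topspace Y \<and> continuous_map X Y \<phi> \<and> \<phi> ` A \<subseteq> B"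

text \<open>The Eilenberg-Steenrod axioms without the dimension axiom, and the weak equivalence axiom.
  The homotopy axiom is listed separately because a cylinder need not be a space with points
  in \<open>'u\<close> if \<open>'u\<close> is small. No additivity over infinite disjoint unions is required.\<close>

locale cohomology_theory =
  fixes K :: "('k, 'm) ring_scheme"
    and E :: "('u, 'k, 'v) cohomology_data"
  assumes field_K: "field K"
    and vectorspace_coh:
      "A \<subseteq> topspace X \<Longrightarrow> vectorspace K (coh E n X A)"
    and linear_induced:
      "pair_map X A Y B \<phi> \<Longrightarrow> linear_map K (coh E n Y B) (coh E n X A) (induced E n X A Y B \<phi>)"
    and linear_conn:
      "A \<subseteq> topspace X \<Longrightarrow>
         linear_map K (coh E n (subtopology X A) {}) (coh E (n + 1) X A) (conn E n X A)"
    and induced_cong: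
      "\<lbrakk>pair_map X A Y B \<phi>; \<And>x. x \<in> topspace X \<Longrightarrow> \<phi> x = \<psi> x; w \<in> carrier (coh E n Y B)\<rbrakk>
         \<Longrightarrow> induced E n X A Y B \<phi> w = induced E n X A Y B \<psi> w"
    and induced_id:
      "\<lbrakk>A \<subseteq> topspace X; w \<in> carrier (coh E n X A)\<rbrakk> \<Longrightarrow> induced E n X A X A id w = w"
    and induced_compose:
      "\<lbrakk>pair_map X A Y B \<phi>; pair_map Y B Z C \<psi>; w \<in> carrier (coh E n Z C)\<rbrakk>
         \<Longrightarrow> induced E n X A Z C (\<psi> \<circ> \<phi>) w = induced E n X A Y B \<phi> (induced E n Y B Z C \<psi> w)"
    and conn_natural:
      "\<lbrakk>pair_map X A Y B \<phi>; w \<in> carrier (coh E n (subtopology Y B) {})\<rbrakk>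
         \<Longrightarrow> induced E (n + 1) X A Y B \<phi> (conn E n Y B w) =
             conn E n X A (induced E n (subtopology X A) {} (subtopology Y B) {} \<phi> w)"
    and exact_absolute:
      "A \<subseteq> topspace X \<Longrightarrow>
         induced E n X {} X A id ` carrier (coh E n X A) =
         {w \<in> carrier (coh E n X {}).
            induced E n (subtopology X A) {} X {} id w = \<zero>\<^bsub>coh E n (subtopology X A) {}\<^esub>}"
    and exact_subspace:
      "A \<subseteq> topspace X \<Longrightarrow>
         induced E n (subtopology X A) {} X {} id ` carrier (coh E n X {}) =
         {w \<in> carrier (coh E n (subtopology X A) {}). conn E n X A w = \<zero>\<^bsub>coh E (n + 1) X A\<^esub>}"
    and exact_relative:
      "A \<subseteq> topspace X \<Longrightarrow>
         conn E n X A ` carrier (coh E n (subtopology X A) {}) =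
         {w \<in> carrier (coh E (n + 1) X A).
            induced E (n + 1) X {} X A id w = \<zero>\<^bsub>coh E (n + 1) X {}\<^esub>}"
    and homotopy_invariance:
      "\<lbrakk>A \<subseteq> topspace X; B \<subseteq> topspace Y; homotopic_with (\<lambda>q. q ` A \<subseteq> B) X Y \<phi> \<psi>;
        w \<in> carrier (coh E n Y B)\<rbrakk>
         \<Longrightarrow> induced E n X A Y B \<phi> w = induced E n X A Y B \<psi> w"
    and excision:
      "\<lbrakk>A \<subseteq> topspace X; X closure_of U \<subseteq> X interior_of A\<rbrakk>
         \<Longrightarrow> bij_betw (induced E n (subtopology X (topspace X - U)) (A - U) X A id)
               (carrier (coh E n X A))
               (carrier (coh E n (subtopology X (topspace X - U)) (A - U)))"
    and weak_equivalence_iso: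
      "\<lbrakk>pair_map X A Y B \<phi>; weak_equivalence X Y \<phi>;
        weak_equivalence (subtopology X A) (subtopology Y B) \<phi>\<rbrakk>
         \<Longrightarrow> bij_betw (induced E n X A Y B \<phi>) (carrier (coh E n Y B)) (carrier (coh E n X A))"

text \<open>The connecting homomorphism of a triple \<open>B \<subseteq> A \<subseteq> X\<close>, from the cohomology of \<open>(A, B)\<close>
  in degree \<open>n\<close> to that of \<open>(X, A)\<close> in degree \<open>n + 1\<close>.\<close>

definition conn_triple ::
  "('u, 'k, 'v) cohomology_data \<Rightarrow> int \<Rightarrow> 'u topology \<Rightarrow> 'u set \<Rightarrow> 'u set \<Rightarrow> 'v \<Rightarrow> 'v" where
  "conn_triple E n X A B w =
     conn E n X A (induced E n (subtopology X A) {} (subtopology X A) B id w)"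


section \<open>Cohomology of pairs of subspaces and the relative Mayer-Vietoris differential\<close>

text \<open>The double mapping cylinders in the construction of the relative Mayer-Vietoris differential
  for subspaces of a space \<open>X\<close> with points in \<open>'a\<close> are subspaces of \<open>X \<times> \<real>\<close>. We thus take
  \<open>'a \<times> real\<close> as universe, and identify every subspace \<open>S\<close> of \<open>X\<close> with \<open>S \<times> {0}\<close>. Any
  cohomology theory on all pairs of spaces can be restricted to this universe.\<close>

definition cyl :: "'a topology \<Rightarrow> ('a \<times> real) set \<Rightarrow> ('a \<times> real) topology" where
  "cyl X S = subtopology (prod_topology X euclideanreal) S"

definition sub_coh ::
  "('a \<times> real, 'k, 'v) cohomology_data \<Rightarrow> 'a topology \<Rightarrow> int \<Rightarrow> 'a set \<times> 'a set \<Rightarrow> ('k, 'v) module"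
  where
  "sub_coh E X n = (\<lambda>(S, T). coh E n (cyl X (S \<times> {0})) (T \<times> {0}))"

definition cyl_restr ::
  "('a \<times> real, 'k, 'v) cohomology_data \<Rightarrow> 'a topology \<Rightarrow> int \<Rightarrow>
   ('a \<times> real) set \<times> ('a \<times> real) set \<Rightarrow> ('a \<times> real) set \<times> ('a \<times> real) set \<Rightarrow> 'v \<Rightarrow> 'v" where
  "cyl_restr E X n = (\<lambda>(S, T) (S', T'). induced E n (cyl X S) T (cyl X S') T' id)"

definition sub_restr ::
  "('a \<times> real, 'k, 'v) cohomology_data \<Rightarrow> 'a topology \<Rightarrow> int \<Rightarrow>
   'a set \<times> 'a set \<Rightarrow> 'a set \<times> 'a set \<Rightarrow> 'v \<Rightarrow> 'v" where
  "sub_restr E X n =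
     (\<lambda>(S, T) (S', T'). cyl_restr E X n (S \<times> {0}, T \<times> {0}) (S' \<times> {0}, T' \<times> {0}))"

text \<open>An open version of the double mapping cylinder of \<open>A \<leftarrow> A \<inter> B \<rightarrow> B\<close>; for open \<open>A\<close> and
  \<open>B\<close> its projection to \<open>A \<union> B\<close> is a weak equivalence.\<close>

definition double_cyl :: "'a set \<Rightarrow> 'a set \<Rightarrow> ('a \<times> real) set" where
  "double_cyl A B = A \<times> {..<0} \<union> (A \<inter> B) \<times> UNIV \<union> B \<times> {1<..}"

text \<open>For pairs \<open>(A, C)\<close> and \<open>(B, D)\<close> of open subspaces, let \<open>(M, N)\<close> be the pair of double
  cylinders, \<open>M1\<close> and \<open>M2\<close> the parts of \<open>M\<close> over the levels below \<open>1\<close> and above \<open>0\<close>, and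
  \<open>N1\<close> the part of \<open>N\<close> in \<open>M1\<close>. Since \<open>M1 \<inter> M2 = (A \<inter> B) \<times> {0<..<1}\<close> and
  \<open>N1 \<inter> M2 = (C \<inter> D) \<times> {0<..<1}\<close>, there is the composition
  \<open>H\<^sup>n(A \<inter> B, C \<inter> D) \<cong> H\<^sup>n(M1 \<inter> M2, N1 \<inter> M2) \<cong> H\<^sup>n((M1 \<inter> M2) \<union> N1, N1)\<close>
  \<open>\<rightarrow> H\<^sup>n\<^sup>+\<^sup>1(M1, (M1 \<inter> M2) \<union> N1) \<cong> H\<^sup>n\<^sup>+\<^sup>1(M, M2 \<union> N1) \<rightarrow> H\<^sup>n\<^sup>+\<^sup>1(M, N) \<cong> H\<^sup>n\<^sup>+\<^sup>1(A \<union> B, C \<union> D)\<close>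
  whose second and third isomorphisms are excisions, and whose other ones are induced by
  the projection. The passage to cylinders is needed as \<open>C \<inter> B\<close> and \<open>C \<inter> D\<close> may differ.\<close>

definition mv_differential ::
  "('a \<times> real, 'k, 'v) cohomology_data \<Rightarrow> 'a topology \<Rightarrow> int \<Rightarrow>
   'a set \<times> 'a set \<Rightarrow> 'a set \<times> 'a set \<Rightarrow> 'v \<Rightarrow> 'v" where
  "mv_differential E X n = (\<lambda>(A, C) (B, D) w.
     let M = double_cyl A B; N = double_cyl C D;
         M1 = M \<inter> UNIV \<times> {..<1}; M2 = M \<inter> UNIV \<times> {0<..}; N1 = N \<inter> M1;
         P = M1 \<inter> M2; Q = N1 \<inter> M2;
         pr = (\<lambda>(x, t). (x, 0));
         w1 = induced E n (cyl X P) Q (cyl X ((A \<inter> B) \<times> {0})) ((C \<inter> D) \<times> {0}) pr w;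
         w2 = inv_into (carrier (coh E n (cyl X (P \<union> N1)) N1))
                (cyl_restr E X n (P, Q) (P \<union> N1, N1)) w1;
         w3 = conn_triple E n (cyl X M1) (P \<union> N1) N1 w2;
         w4 = inv_into (carrier (coh E (n + 1) (cyl X M) (M2 \<union> N1)))
                (cyl_restr E X (n + 1) (M1, P \<union> N1) (M, M2 \<union> N1)) w3;
         w5 = cyl_restr E X (n + 1) (M, N) (M, M2 \<union> N1) w4
     in inv_into (carrier (sub_coh E X (n + 1) (A \<union> B, C \<union> D)))
          (induced E (n + 1) (cyl X M) N (cyl X ((A \<union> B) \<times> {0})) ((C \<union> D) \<times> {0}) pr) w5)"


section \<open>The strip\<close>

definition strip :: "(real \<times> real) set" where
  "strip = {(x, y). - pi \<le> x + y \<and> x + y \<le> pi}"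

definition strip_le :: "real \<times> real \<Rightarrow> real \<times> real \<Rightarrow> bool"  (infix "\<preceq>\<^sub>M" 50) where
  "u \<preceq>\<^sub>M v \<longleftrightarrow> fst u \<ge> fst v \<and> snd u \<le> snd v"

definition strip_T :: "real \<times> real \<Rightarrow> real \<times> real" where
  "strip_T = (\<lambda>(x, y). (- pi - y, pi - x))"

definition strip_T_pow :: "int \<Rightarrow> real \<times> real \<Rightarrow> real \<times> real" where
  "strip_T_pow n = (if n \<ge> 0 then strip_T ^^ nat n else (inv_into UNIV strip_T) ^^ nat (- n))"

definition strip_D :: "(real \<times> real) set" where
  "strip_D = {(x, y) \<in> strip. 0 \<le> x - y \<and> x - y < 2 * pi}"

text \<open>The index \<open>n\<close> of the translate \<open>T\<^sup>-\<^sup>n(D)\<close> of the fundamental domain containing \<open>u\<close>.\<close>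

definition strip_index :: "real \<times> real \<Rightarrow> int" where
  "strip_index u = (THE n. u \<in> strip_T_pow (- n) ` strip_D)"

lemma funpow_cancel:
  fixes f g :: "'b \<Rightarrow> 'b"
  assumes "\<And>v. g (f v) = v"
  shows "(g ^^ k) ((f ^^ k) v) = v"
proof (induction k)
  case (Suc k)
  have "(g ^^ Suc k) ((f ^^ Suc k) v) = (g ^^ k) (g (f ((f ^^ k) v)))"
    by (simp only: funpow_Suc_right[of k g] funpow.simps(2)[of k f] comp_apply)
  with Suc show ?case
    by (simp only: assms)
qed simp

lemma strip_T_inv:
  "strip_T (inv_into UNIV strip_T u) = u" "inv_into UNIV strip_T (strip_T u) = u"
proof -
  have "inj strip_T"
    by (auto simp: inj_def strip_T_def)
  then show "inv_into UNIV strip_T (strip_T u) = u"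
    by simp
  have "u = strip_T (pi - snd u, - pi - fst u)"
    by (cases u) (simp add: strip_T_def)
  then show "strip_T (inv_into UNIV strip_T u) = u"
    by (metis f_inv_into_f rangeI)
qed

lemma strip_T_strip_diff:
  "strip_T u \<in> strip \<longleftrightarrow> u \<in> strip"
  "fst (strip_T u) - snd (strip_T u) = fst u - snd u - 2 * pi"
  by (auto simp: strip_def strip_T_def split: prod.splits)

lemma strip_T_pow_strip_diff:
  assumes "u \<in> strip"
  shows "strip_T_pow n u \<in> strip"
    and "fst (strip_T_pow n u) - snd (strip_T_pow n u) = fst u - snd u - 2 * pi * of_int n"
proof -
  let ?T' = "inv_into UNIV strip_T"
  have T': "?T' v \<in> strip \<longleftrightarrow> v \<in> strip" "fst (?T' v) - snd (?T' v) = fst v - snd v + 2 * pi" for v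
    using strip_T_strip_diff[of "?T' v"] by (simp_all add: strip_T_inv)
  have pos: "(strip_T ^^ k) u \<in> strip \<and>
      fst ((strip_T ^^ k) u) - snd ((strip_T ^^ k) u) = fst u - snd u - 2 * pi * real k" for k
    by (induction k) (simp_all add: assms strip_T_strip_diff distrib_left)
  have neg: "(?T' ^^ k) u \<in> strip \<and>
      fst ((?T' ^^ k) u) - snd ((?T' ^^ k) u) = fst u - snd u + 2 * pi * real k" for k
    by (induction k) (simp_all add: assms T' distrib_left)
  show "strip_T_pow n u \<in> strip"
    using pos neg by (simp add: strip_T_pow_def)
  show "fst (strip_T_pow n u) - snd (strip_T_pow n u) = fst u - snd u - 2 * pi * of_int n"
    using pos[of "nat n"] neg[of "nat (- n)"] by (simp add: strip_T_pow_def)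
qed

lemma strip_T_pow_uminus: "strip_T_pow (- n) (strip_T_pow n u) = u"
proof -
  let ?T' = "inv_into UNIV strip_T"
  have "(?T' ^^ k) ((strip_T ^^ k) v) = v" for k v
    by (rule funpow_cancel) (rule strip_T_inv)
  moreover have "(strip_T ^^ k) ((?T' ^^ k) v) = v" for k v
    by (rule funpow_cancel) (rule strip_T_inv)
  ultimately show ?thesis
    by (cases n "0::int" rule: linorder_cases) (simp_all add: strip_T_pow_def)
qed

lemma strip_index_eq:
  assumes "u \<in> strip"
  shows "strip_index u = \<lfloor>(fst u - snd u) / (2 * pi)\<rfloor>"
    and "u \<in> strip_T_pow (- strip_index u) ` strip_D"
proof -
  have D: "strip_T_pow n u \<in> strip_D \<longleftrightarrow> n = \<lfloor>(fst u - snd u) / (2 * pi)\<rfloor>" for n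
  proof -
    let ?d = "fst u - snd u"
    have "strip_T_pow n u \<in> strip_D \<longleftrightarrow> 0 \<le> ?d - 2 * pi * of_int n \<and> ?d - 2 * pi * of_int n < 2 * pi"
      using strip_T_pow_strip_diff[OF assms, of n]
      by (simp add: strip_D_def case_prod_beta) linarith
    also have "\<dots> \<longleftrightarrow> of_int n \<le> ?d / (2 * pi) \<and> ?d / (2 * pi) < of_int n + 1"
      by (simp add: pos_le_divide_eq pos_divide_less_eq distrib_right mult.commute) linarith
    also have "\<dots> \<longleftrightarrow> n = \<lfloor>?d / (2 * pi)\<rfloor>"
      by (simp add: eq_commute[of n] floor_eq_iff)
    finally show ?thesis .
  qed
  have image: "u \<in> strip_T_pow (- n) ` strip_D \<longleftrightarrow> strip_T_pow n u \<in> strip_D" for n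
  proof
    assume "u \<in> strip_T_pow (- n) ` strip_D"
    then obtain v where "v \<in> strip_D" "u = strip_T_pow (- n) v"
      by blast
    then show "strip_T_pow n u \<in> strip_D"
      using strip_T_pow_uminus[of "- n" v] by simp
  next
    assume "strip_T_pow n u \<in> strip_D"
    then show "u \<in> strip_T_pow (- n) ` strip_D"
      by (rule rev_image_eqI) (simp add: strip_T_pow_uminus)
  qed
  show eq: "strip_index u = \<lfloor>(fst u - snd u) / (2 * pi)\<rfloor>"
    unfolding strip_index_def image D by simp
  show "u \<in> strip_T_pow (- strip_index u) ` strip_D"
    unfolding image D eq ..
qed


section \<open>The functor and the two finiteness conditions\<close>

definition rho1 :: "real \<times> real \<Rightarrow> real set" where
  "rho1 = (\<lambda>(x, y). {t. - pi - y < arctan t \<and> arctan t < pi - x})"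

definition rho0 :: "real \<times> real \<Rightarrow> real set" where
  "rho0 = (\<lambda>(x, y). {t. arctan t < y \<or> arctan t > x})"

definition preim :: "'a topology \<Rightarrow> ('a \<Rightarrow> real) \<Rightarrow> real set \<Rightarrow> 'a set" where
  "preim X f U = {x \<in> topspace X. f x \<in> U}"

definition preim_rho ::
  "'a topology \<Rightarrow> ('a \<Rightarrow> real) \<Rightarrow> real \<times> real \<Rightarrow> 'a set \<times> 'a set" where
  "preim_rho X f u = (preim X f (rho1 u), preim X f (rho0 u))"

text \<open>The data of a contravariant functor from the strip to vector spaces; \<open>internal_map F u v\<close>,
  meaningful for \<open>u \<preceq>\<^sub>M v\<close> in the strip, is the map from \<open>value_at F v\<close> to \<open>value_at F u\<close>.\<close>

record ('k, 'v) strip_functor =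
  value_at :: "real \<times> real \<Rightarrow> ('k, 'v) module"
  internal_map :: "real \<times> real \<Rightarrow> real \<times> real \<Rightarrow> 'v \<Rightarrow> 'v"

definition h_value ::
  "('a \<times> real, 'k, 'v) cohomology_data \<Rightarrow> 'a topology \<Rightarrow> ('a \<Rightarrow> real) \<Rightarrow>
   real \<times> real \<Rightarrow> ('k, 'v) module" where
  "h_value E X f u =
     (let n = strip_index u in sub_coh E X n (preim_rho X f (strip_T_pow n u)))"

definition h_map ::
  "('a \<times> real, 'k, 'v) cohomology_data \<Rightarrow> 'a topology \<Rightarrow> ('a \<Rightarrow> real) \<Rightarrow>
   real \<times> real \<Rightarrow> real \<times> real \<Rightarrow> 'v \<Rightarrow> 'v" where
  "h_map E X f u v w =
     (let n = strip_index u in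
      if strip_index v = n then
        sub_restr E X n (preim_rho X f (strip_T_pow n u)) (preim_rho X f (strip_T_pow n v)) w
      else if strip_index v = n - 1 \<and> v \<preceq>\<^sub>M strip_T u then
        (let (x, y) = strip_T_pow (n - 1) v; (x', y') = strip_T_pow n u in
         mv_differential E X (n - 1) (preim_rho X f (x', y)) (preim_rho X f (x, y')) w)
      else \<zero>\<^bsub>h_value E X f u\<^esub>)"

definition h_functor ::
  "('a \<times> real, 'k, 'v) cohomology_data \<Rightarrow> 'a topology \<Rightarrow> ('a \<Rightarrow> real) \<Rightarrow>
   ('k, 'v) strip_functor" where
  "h_functor E X f = \<lparr>value_at = h_value E X f, internal_map = h_map E X f\<rparr>"

definition pointwise_fin_dim :: "('k, 'm) ring_scheme \<Rightarrow> ('k, 'v) strip_functor \<Rightarrow> bool" where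
  "pointwise_fin_dim K F \<longleftrightarrow> (\<forall>u\<in>strip. vectorspace.fin_dim K (value_at F u))"

text \<open>Open intervals, bounded or not, are the open order-convex subsets.\<close>

definition tame ::
  "('k, 'm) ring_scheme \<Rightarrow> ('a \<times> real, 'k, 'v) cohomology_data \<Rightarrow> 'a topology \<Rightarrow> ('a \<Rightarrow> real) \<Rightarrow> bool"
  where
  "tame K E X f \<longleftrightarrow>
     (\<forall>n I. open I \<and> is_interval I \<longrightarrow> vectorspace.fin_dim K (sub_coh E X n (preim X f I, {})))"

end

theory Submission
  imports Defs
begin

text \<open>Both conditions say that certain cohomology spaces are finite-dimensional. As \<open>T\<^sup>n\<close> maps
  \<open>T\<^sup>-\<^sup>n(D)\<close> onto \<open>D\<close>, the functor \<open>h(f)\<close> is pointwise finite-dimensional if and only if the pair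
  \<open>f\<^sup>-\<^sup>1(\<rho>(p))\<close> has finite-dimensional cohomology in every degree for every \<open>p \<in> D\<close>
  (\<open>pointwise_fin_dim_h_functor_iff\<close>).

  Let \<open>f\<close> be tame and \<open>p = (x, y) \<in> D\<close>. Then \<open>\<rho>\<^sub>1(p)\<close> is an open interval. Since \<open>y \<le> x\<close>, the set
  \<open>\<rho>\<^sub>0(p)\<close> is the disjoint union of the open intervals \<open>arctan t < y\<close> and \<open>arctan t > x\<close>, so its
  preimage has finite-dimensional cohomology by excision and the exact sequence of a pair
  (\<open>fin_dim_disjoint_union\<close>). The exact sequence of the pair \<open>f\<^sup>-\<^sup>1(\<rho>(p))\<close> then puts its cohomology
  between two finite-dimensional spaces (\<open>fin_dim_pair\<close>).

  Conversely, every nonempty open interval \<open>I\<close> is \<open>\<rho>\<^sub>1(p)\<close> for a point \<open>p \<in> D\<close> with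
  \<open>\<rho>\<^sub>0(p) = \<emptyset>\<close> (\<open>rho_of_open_interval\<close>), so in each degree the cohomology of
  \<open>f\<^sup>-\<^sup>1(I)\<close> is itself a value of \<open>h(f)\<close>. The cohomology of the empty space vanishes.\<close>


section \<open>Finite dimensionality and exact sequences\<close>

text \<open>Linear independence does not depend on the ambient space, so the linearly independent subsets
  of a subspace have bounded size, and a maximal one generates the subspace.\<close>

lemma (in vectorspace) fin_dim_subspace:
  assumes "subspace K N V" and "fin_dim"
  shows "vectorspace.fin_dim K (vs N)"
proof -
  interpret N: vectorspace K "vs N"
    by (rule subspace_is_vs[OF assms(1)])
  have sub: "submodule K N V"
    using assms(1) by simp
  have N: "N \<subseteq> carrier V"
    using sub by (rule submodule.subset)
  let ?P = "\<lambda>S. S \<subseteq> carrier (vs N) \<and> \<not> N.lin_dep S"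
  have bound: "finite A \<and> card A \<le> dim" if "?P A" for A
    using that span_li_not_depend(2)[OF _ sub, of A] li_le_dim[OF assms(2), of A] N by auto
  have "?P {}"
    by (simp add: N.lin_dep_def)
  with bound have "\<exists>A. finite A \<and> maximal A ?P"
    by (rule maximal_exists)
  then obtain A where A: "finite A" "maximal A ?P"
    by blast
  have "A \<subseteq> carrier (vs N)"
    using A(2) unfolding maximal_def by blast
  with A(1) N.max_li_is_gen[OF A(2)] show ?thesis
    unfolding N.fin_dim_def by blast
qed

text \<open>The kernel is finite-dimensional by hypothesis, the image as a subspace of the codomain. A
  generating set consists of \<open>B\<close> and of preimages of generators of the image.\<close>

lemma (in linear_map) fin_dim_if_ker_subset_span:
  assumes "finite B" and B: "B \<subseteq> carrier V"
    and ker: "\<And>v. v \<in> carrier V \<Longrightarrow> T v = \<zero>\<^bsub>W\<^esub> \<Longrightarrow> v \<in> V.module.span B"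
    and "W.fin_dim"
  shows "V.fin_dim"
proof -
  interpret im: vectorspace K "W.vs imT"
    using imT_is_subspace W.subspace_is_vs by blast
  have "im.fin_dim"
    using imT_is_subspace assms(4) by (rule W.fin_dim_subspace)
  then obtain C where C: "finite C" "C \<subseteq> imT" "im.span C = imT"
    unfolding im.fin_dim_def by auto
  then obtain A where A: "finite A" "A \<subseteq> carrier V" "T ` A = C"
    unfolding im_def by (metis finite_subset_image)
  let ?S = "V.module.span (A \<union> B)"
  have AB: "A \<union> B \<subseteq> carrier V"
    using A B by blast
  have subS: "submodule K ?S V"
    by (rule V.module.span_is_submodule[OF AB])
  have S: "?S \<subseteq> carrier V"
    by (rule V.module.span_is_subset2[OF AB])
  have own: "A \<union> B \<subseteq> ?S"
    by (rule V.module.in_own_span[OF AB])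
  have TS: "submodule K (T ` ?S) W"
  proof
    show "T ` ?S \<subseteq> carrier W"
      using S by auto
    show "\<zero>\<^bsub>W\<^esub> \<in> T ` ?S"
      using submodule.zero_closed[OF subS] by (rule rev_image_eqI) simp
    show "v \<oplus>\<^bsub>W\<^esub> w \<in> T ` ?S" if "v \<in> T ` ?S" "w \<in> T ` ?S" for v w
    proof -
      obtain a b where ab: "a \<in> ?S" "b \<in> ?S" "v = T a" "w = T b"
        using \<open>v \<in> T ` ?S\<close> \<open>w \<in> T ` ?S\<close> by blast
      show ?thesis
        using ab S by (intro rev_image_eqI[OF submodule.m_closed[OF subS ab(1,2)]]) (simp add: subset_iff)
    qed
    show "c \<odot>\<^bsub>W\<^esub> v \<in> T ` ?S" if "c \<in> carrier K" "v \<in> T ` ?S" for c v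
    proof -
      obtain a where a: "a \<in> ?S" "v = T a"
        using \<open>v \<in> T ` ?S\<close> by blast
      show ?thesis
        using a S that(1)
        by (intro rev_image_eqI[OF submodule.smult_closed[OF subS that(1) a(1)]]) (simp add: subset_iff)
    qed
  qed
  have "im.span C = W.module.span C"
    using C(2) imT_is_subspace W.module.span_li_not_depend(1) by auto
  also have "\<dots> \<subseteq> T ` ?S"
    using own A(3) by (intro W.module.span_is_subset[OF _ TS]) blast
  finally have im: "imT \<subseteq> T ` ?S"
    using C(3) by simp
  have "v \<in> ?S" if v: "v \<in> carrier V" for v
  proof -
    from im v obtain s where s: "s \<in> ?S" "T v = T s"
      unfolding im_def by blast
    with S have sV: "s \<in> carrier V"
      by blast
    have "T (v \<ominus>\<^bsub>V\<^esub> s) = \<zero>\<^bsub>W\<^esub>"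
      using v sV s(2) by (simp add: W.module.M.r_neg a_minus_def)
    then have "v \<ominus>\<^bsub>V\<^esub> s \<in> V.module.span B"
      using v sV by (intro ker) auto
    then have "v \<ominus>\<^bsub>V\<^esub> s \<in> ?S"
      using V.module.span_is_monotone[of B "A \<union> B"] by blast
    then have "(v \<ominus>\<^bsub>V\<^esub> s) \<oplus>\<^bsub>V\<^esub> s \<in> ?S"
      using s(1) by (rule submodule.m_closed[OF subS])
    moreover have "(v \<ominus>\<^bsub>V\<^esub> s) \<oplus>\<^bsub>V\<^esub> s = v"
      using v sV by (simp add: a_minus_def V.module.M.a_assoc V.module.M.l_neg)
    ultimately show ?thesis
      by simp
  qed
  with S have "?S = carrier V"
    by blast
  with AB A(1) assms(1) show ?thesis
    unfolding V.fin_dim_def by (intro exI[of _ "A \<union> B"]) simp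
qed

text \<open>The images of finitely many generators of \<open>U\<close> span the kernel of \<open>g\<close>.\<close>

lemma fin_dim_exact:
  assumes f: "linear_map K U V f" and g: "linear_map K V W g"
    and exact: "f ` carrier U = {v \<in> carrier V. g v = \<zero>\<^bsub>W\<^esub>}"
    and "vectorspace.fin_dim K U" and "vectorspace.fin_dim K W"
  shows "vectorspace.fin_dim K V"
proof -
  interpret f: linear_map K U V f by (rule f)
  interpret g: linear_map K V W g by (rule g)
  obtain B where B: "finite B" "B \<subseteq> carrier U" "f.V.module.span B = carrier U"
    using assms(4) unfolding f.V.fin_dim_def by blast
  have fB: "f ` B \<subseteq> carrier V"
    using B(2) by auto
  let ?P = "{u \<in> carrier U. f u \<in> f.W.module.span (f ` B)}"
  have subS: "submodule K (f.W.module.span (f ` B)) V"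
    by (rule f.W.module.span_is_submodule[OF fB])
  have "submodule K ?P U"
    using submodule.m_closed[OF subS] submodule.zero_closed[OF subS] submodule.smult_closed[OF subS]
    by unfold_locales auto
  moreover have "B \<subseteq> ?P"
    using B(2) f.W.module.in_own_span[OF fB] by blast
  ultimately have "carrier U \<subseteq> ?P"
    using f.V.module.span_is_subset B(3) by blast
  then have "f ` carrier U \<subseteq> f.W.module.span (f ` B)"
    by blast
  with exact have "v \<in> f.W.module.span (f ` B)" if "v \<in> carrier V" "g v = \<zero>\<^bsub>W\<^esub>" for v
    using that by blast
  with B(1) fB show ?thesis
    using assms(5) by (rule g.fin_dim_if_ker_subset_span[OF finite_imageI])
qed

lemma (in linear_map) fin_dim_if_inj:
  assumes inj: "inj_on T (carrier V)" and "W.fin_dim"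
  shows "V.fin_dim"
proof (rule fin_dim_if_ker_subset_span[of "{}"])
  fix v assume "v \<in> carrier V" "T v = \<zero>\<^bsub>W\<^esub>"
  then have "v = \<zero>\<^bsub>V\<^esub>"
    using inj_onD[OF inj, of v "\<zero>\<^bsub>V\<^esub>"] by simp
  then show "v \<in> V.module.span {}"
    by (simp add: V.span_empty)
qed (use assms in auto)


section \<open>Finite-dimensional cohomology of spaces and pairs\<close>

context cohomology_theory
begin

lemma pair_map_id:
  assumes "A \<subseteq> B" "B \<subseteq> topspace X"
  shows "pair_map X A X B id"
  using assms by (auto simp: pair_map_def)

lemma pair_map_id_subspace:
  assumes "A \<subseteq> topspace X"
  shows "pair_map (subtopology X A) {} X {} id"
  using assms by (auto simp: pair_map_def intro: continuous_map_from_subtopology)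

lemma fin_dim_pair:
  assumes "A \<subseteq> topspace X"
    and "vectorspace.fin_dim K (coh E n (subtopology X A) {})"
    and "vectorspace.fin_dim K (coh E (n + 1) X {})"
  shows "vectorspace.fin_dim K (coh E (n + 1) X A)"
  using linear_conn[OF assms(1)] linear_induced[OF pair_map_id[OF _ assms(1)]]
    exact_relative[OF assms(1)] assms(2,3)
  by (rule fin_dim_exact) simp

lemma fin_dim_total_space:
  assumes "A \<subseteq> topspace X"
    and "vectorspace.fin_dim K (coh E n X A)"
    and "vectorspace.fin_dim K (coh E n (subtopology X A) {})"
  shows "vectorspace.fin_dim K (coh E n X {})"
  using linear_induced[OF pair_map_id[OF _ assms(1)]]
    linear_induced[OF pair_map_id_subspace[OF assms(1)]]
    exact_absolute[OF assms(1)] assms(2,3)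
  by (rule fin_dim_exact) simp

text \<open>The subset \<open>A\<close> is both open and closed, so it can be excised from the pair \<open>(X, A)\<close>, which
  leaves \<open>(B, \<emptyset>)\<close>. Hence in the exact sequence of \<open>(X, A)\<close> the cohomology of \<open>X\<close> lies between
  those of \<open>B\<close> and of \<open>A\<close>.\<close>

lemma fin_dim_disjoint_union:
  assumes "openin X A" "openin X B" "A \<inter> B = {}" "A \<union> B = topspace X"
    and "vectorspace.fin_dim K (coh E n (subtopology X A) {})"
    and "vectorspace.fin_dim K (coh E n (subtopology X B) {})"
  shows "vectorspace.fin_dim K (coh E n X {})"
proof -
  have A: "A \<subseteq> topspace X" and B: "topspace X - A = B"
    using assms(3,4) by auto
  have "X closure_of A = A"
    using assms(2) A B by (auto simp: closure_of_eq closedin_def)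
  then have "bij_betw (induced E n (subtopology X B) {} X A id)
      (carrier (coh E n X A)) (carrier (coh E n (subtopology X B) {}))"
    using excision[OF A, of A n] interior_of_openin[OF assms(1)] by (simp add: B)
  moreover have "linear_map K (coh E n X A) (coh E n (subtopology X B) {})
      (induced E n (subtopology X B) {} X A id)"
    using A by (intro linear_induced)
      (auto simp: pair_map_def intro: continuous_map_from_subtopology)
  ultimately have "vectorspace.fin_dim K (coh E n X A)"
    using assms(6) by (metis linear_map.fin_dim_if_inj bij_betw_imp_inj_on)
  with A show ?thesis
    using assms(5) by (rule fin_dim_total_space)
qed

text \<open>For the pair \<open>(\<emptyset>, \<emptyset>)\<close> the two maps in the exact sequence through the cohomology of \<open>\<emptyset>\<close> are
  identities, so exactness says that every class is zero.\<close>

lemma fin_dim_empty_space: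
  assumes "topspace X = {}"
  shows "vectorspace.fin_dim K (coh E n X {})"
proof -
  interpret vectorspace K "coh E n X {}"
    by (rule vectorspace_coh) simp
  have X: "subtopology X {} = X"
    using assms by (metis subtopology_topspace)
  have id: "induced E n X {} X {} id w = w" if "w \<in> carrier (coh E n X {})" for w
    using induced_id[of "{}" X w n] that by simp
  have "induced E n X {} X {} id ` carrier (coh E n X {}) =
      {w \<in> carrier (coh E n X {}). induced E n X {} X {} id w = \<zero>\<^bsub>coh E n X {}\<^esub>}"
    using exact_absolute[of "{}" X n] unfolding X by simp
  then have "carrier (coh E n X {}) = {w \<in> carrier (coh E n X {}). w = \<zero>\<^bsub>coh E n X {}\<^esub>}"
    by (simp add: id cong: image_cong_simp conj_cong)
  then have "carrier (coh E n X {}) = span {}"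
    by (auto simp: span_empty)
  then show ?thesis
    unfolding fin_dim_def by (intro exI[of _ "{}"]) simp
qed

end


section \<open>Subspaces as zero sections of the cylinder\<close>

lemma topspace_cyl: "topspace (cyl X S) = (topspace X \<times> UNIV) \<inter> S"
  by (simp add: cyl_def)

lemma subtopology_cyl: "T \<subseteq> S \<Longrightarrow> subtopology (cyl X S) T = cyl X T"
  by (simp add: cyl_def subtopology_subtopology Int_absorb1)

lemma openin_cyl_zero_section:
  assumes "openin X A" "A \<subseteq> S"
  shows "openin (cyl X (S \<times> {0})) (A \<times> {0})"
proof -
  have "A \<times> {0} = (A \<times> UNIV) \<inter> (S \<times> {0})"
    using assms(2) by auto
  moreover have "openin (prod_topology X euclideanreal) (A \<times> UNIV)"
    using assms(1) by (simp add: openin_prod_Times_iff)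
  ultimately show ?thesis
    unfolding cyl_def openin_subtopology by blast
qed

lemma fin_dim_sub_coh_pair:
  fixes E :: "('a \<times> real, 'k, 'v) cohomology_data"
  assumes "cohomology_theory K E" "T \<subseteq> S" "S \<subseteq> topspace X"
    and "vectorspace.fin_dim K (sub_coh E X (n - 1) (T, {}))"
    and "vectorspace.fin_dim K (sub_coh E X n (S, {}))"
  shows "vectorspace.fin_dim K (sub_coh E X n (S, T))"
proof -
  have "T \<times> {0} \<subseteq> S \<times> {0::real}"
    using assms(2) by blast
  then show ?thesis
    using assms(3-5)
      cohomology_theory.fin_dim_pair[OF assms(1), of "T \<times> {0}" "cyl X (S \<times> {0})" "n - 1"]
    by (auto simp: sub_coh_def topspace_cyl subtopology_cyl)
qed

lemma fin_dim_sub_coh_disjoint_union: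
  fixes E :: "('a \<times> real, 'k, 'v) cohomology_data"
  assumes "cohomology_theory K E" "openin X A" "openin X B" "A \<inter> B = {}"
    and "vectorspace.fin_dim K (sub_coh E X n (A, {}))"
    and "vectorspace.fin_dim K (sub_coh E X n (B, {}))"
  shows "vectorspace.fin_dim K (sub_coh E X n (A \<union> B, {}))"
proof -
  let ?Y = "cyl X ((A \<union> B) \<times> {0})"
  have "A \<times> {0} \<union> B \<times> {0} = topspace ?Y"
    using assms(2,3)[THEN openin_subset] by (auto simp: topspace_cyl)
  moreover have "A \<times> {0::real} \<subseteq> (A \<union> B) \<times> {0}" "B \<times> {0::real} \<subseteq> (A \<union> B) \<times> {0}"
    by auto
  ultimately show ?thesis
    using cohomology_theory.fin_dim_disjoint_union[OF assms(1), of ?Y "A \<times> {0}" "B \<times> {0}" n]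
      openin_cyl_zero_section[OF assms(2), of "A \<union> B"]
      openin_cyl_zero_section[OF assms(3), of "A \<union> B"] assms(4-6)
    by (auto simp: sub_coh_def subtopology_cyl)
qed

lemma fin_dim_sub_coh_empty:
  fixes E :: "('a \<times> real, 'k, 'v) cohomology_data"
  assumes "cohomology_theory K E"
  shows "vectorspace.fin_dim K (sub_coh E X n ({}, {}))"
  using cohomology_theory.fin_dim_empty_space[OF assms, of "cyl X ({} \<times> {0})" n]
  by (simp add: sub_coh_def topspace_cyl)


section \<open>The strip and open intervals\<close>

text \<open>The translates \<open>T\<^sup>-\<^sup>n(D)\<close> cover the strip, and each is mapped onto \<open>D\<close> by \<open>T\<^sup>n\<close>. So degree and
  point of \<open>D\<close> can be prescribed independently.\<close>

lemma pointwise_fin_dim_h_functor_iff: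
  "pointwise_fin_dim K (h_functor E X f) \<longleftrightarrow>
     (\<forall>n. \<forall>p\<in>strip_D. vectorspace.fin_dim K (sub_coh E X n (preim_rho X f p)))"
proof -
  have onto: "\<exists>u\<in>strip. strip_index u = n \<and> strip_T_pow n u = p" if p: "p \<in> strip_D" for n p
  proof -
    let ?u = "strip_T_pow (- n) p"
    have strip: "p \<in> strip" and bounds: "0 \<le> fst p - snd p" "fst p - snd p < 2 * pi"
      using p by (auto simp: strip_D_def)
    have u: "?u \<in> strip" "fst ?u - snd ?u = fst p - snd p + 2 * pi * of_int n"
      using strip_T_pow_strip_diff[OF strip, of "- n"] by simp_all
    have "\<lfloor>(fst ?u - snd ?u) / (2 * pi)\<rfloor> = n"
      unfolding u(2) floor_eq_iff using bounds by (simp add: field_simps)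
    moreover have "strip_T_pow n ?u = p"
      using strip_T_pow_uminus[of "- n" p] by simp
    ultimately show ?thesis
      using u(1) strip_index_eq(1) by metis
  qed
  have into: "strip_T_pow (strip_index u) u \<in> strip_D" if u: "u \<in> strip" for u
  proof -
    obtain d where "d \<in> strip_D" "u = strip_T_pow (- strip_index u) d"
      using strip_index_eq(2)[OF u] by blast
    then show ?thesis
      using strip_T_pow_uminus[of "- strip_index u" d] by simp
  qed
  have "(\<forall>u\<in>strip. Q (strip_index u) (strip_T_pow (strip_index u) u)) \<longleftrightarrow>
      (\<forall>n. \<forall>p\<in>strip_D. Q n p)" for Q
  proof (intro iffI ballI allI)
    fix n p
    assume Q: "\<forall>u\<in>strip. Q (strip_index u) (strip_T_pow (strip_index u) u)"
      and "p \<in> strip_D"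
    then obtain u where "u \<in> strip" "strip_index u = n" "strip_T_pow n u = p"
      using onto by blast
    with Q show "Q n p"
      by blast
  qed (use into in blast)
  then show ?thesis
    by (simp add: pointwise_fin_dim_def h_functor_def h_value_def Let_def)
qed

text \<open>If \<open>arctan\<close> maps \<open>I\<close> onto the interval from \<open>a\<close> to \<open>b\<close>, then \<open>p = (\<pi> - b, - \<pi> - a)\<close> is forced
  by the shape of \<open>\<rho>\<^sub>1\<close>. The bounds \<open>- \<pi>/2 \<le> a < b \<le> \<pi>/2\<close> then put \<open>p\<close> into \<open>D\<close> and make both
  parts of \<open>\<rho>\<^sub>0(p)\<close> empty. They include unbounded intervals, for which \<open>a\<close> or \<open>b\<close> is \<open>\<plusminus> \<pi>/2\<close>.\<close>

lemma rho_of_open_interval: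
  assumes "open I" "is_interval I" "I \<noteq> {}"
  shows "\<exists>p\<in>strip_D. rho1 p = I \<and> rho0 p = {}"
proof -
  define a b where "a = Inf (arctan ` I)" and "b = Sup (arctan ` I)"
  have bdd: "bdd_below (arctan ` I)" "bdd_above (arctan ` I)"
    using arctan_lbound arctan_ubound by (meson bdd_belowI2 bdd_aboveI2 less_imp_le)+
  have ne: "arctan ` I \<noteq> {}"
    using assms(3) by simp
  have "- (pi / 2) \<le> arctan t" "arctan t \<le> pi / 2" for t
    using arctan_lbound[of t] arctan_ubound[of t] by simp_all
  then have ge: "- (pi / 2) \<le> a" and le: "b \<le> pi / 2"
    unfolding a_def b_def using cInf_greatest[OF ne] cSup_least[OF ne] by blast+
  have mem: "a < arctan t \<and> arctan t < b" if t: "t \<in> I" for t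
  proof -
    \<comment> \<open>The bounds are strict at points of \<open>I\<close>, as \<open>I\<close> is open and \<open>arctan\<close> strictly increasing.\<close>
    obtain e where e: "e > 0" "\<And>s. dist s t < e \<Longrightarrow> s \<in> I"
      using assms(1) t unfolding open_dist by blast
    have "t - e / 2 \<in> I" "t + e / 2 \<in> I"
      using e(1) by (auto intro!: e(2) simp: dist_real_def)
    then have "a \<le> arctan (t - e / 2)" "arctan (t + e / 2) \<le> b"
      unfolding a_def b_def using bdd by (auto intro: cInf_lower cSup_upper)
    moreover have "arctan (t - e / 2) < arctan t" "arctan t < arctan (t + e / 2)"
      using e(1) by (simp_all add: arctan_less_iff)
    ultimately show ?thesis
      by linarith
  qed
  have "t \<in> I" if t: "a < arctan t" "arctan t < b" for t
  proof -
    obtain r s where "r \<in> I" "arctan r < arctan t" "s \<in> I" "arctan t < arctan s"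
      using t ne bdd unfolding a_def b_def by (auto simp: cInf_less_iff less_cSup_iff)
    then have "r \<le> t" "t \<le> s"
      by (simp_all add: arctan_less_iff)
    with \<open>r \<in> I\<close> \<open>s \<in> I\<close> show ?thesis
      using assms(2) unfolding is_interval_1 by blast
  qed
  with mem have I: "I = {t. a < arctan t \<and> arctan t < b}"
    by blast
  have "a < b"
    using assms(3) I by force
  then have "(pi - b, - pi - a) \<in> strip_D"
    using ge le by (auto simp: strip_D_def strip_def)
  moreover have "rho1 (pi - b, - pi - a) = I"
    by (simp add: rho1_def I)
  moreover have "rho0 (pi - b, - pi - a) = {}"
  proof -
    have "\<not> arctan t < - pi - a" "\<not> pi - b < arctan t" for t
      using ge le arctan_lbound[of t] arctan_ubound[of t] by linarith+
    then show ?thesis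
      by (simp add: rho0_def)
  qed
  ultimately show ?thesis
    by blast
qed

lemma is_interval_vimage_mono:
  fixes g :: "real \<Rightarrow> real"
  assumes "mono g" "is_interval J"
  shows "is_interval (g -` J)"
  unfolding is_interval_1
proof (intro ballI allI impI)
  fix a b x assume "a \<in> g -` J" "b \<in> g -` J" "a \<le> x \<and> x \<le> b"
  then have "g a \<in> J" "g b \<in> J" "g a \<le> g x" "g x \<le> g b"
    using assms(1) by (auto dest: monoD)
  then show "x \<in> g -` J"
    using assms(2) unfolding is_interval_1 by blast
qed

text \<open>If \<open>arctan t < y\<close>, then \<open>arctan t < \<pi> - x\<close> since \<open>x + y \<le> \<pi>\<close>. If moreover
  \<open>arctan t \<le> - \<pi> - y\<close> held, then adding both inequalities would give \<open>arctan t < - \<pi>/2\<close>. The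
  other half of \<open>\<rho>\<^sub>0\<close> is symmetric.\<close>

lemma rho0_subset_rho1:
  assumes "p \<in> strip"
  shows "rho0 p \<subseteq> rho1 p"
proof -
  obtain x y where p: "p = (x, y)" and bounds: "- pi \<le> x + y" "x + y \<le> pi"
    using assms by (auto simp: strip_def)
  have "- pi - y < arctan t \<and> arctan t < pi - x" if "arctan t < y \<or> x < arctan t" for t
    using that bounds arctan_lbound[of t] arctan_ubound[of t] by linarith
  then show ?thesis
    by (auto simp: p rho0_def rho1_def)
qed


section \<open>Tameness and pointwise finite dimensionality\<close>

lemma fin_dim_preim_rho_if_tame:
  fixes E :: "('a \<times> real, 'k, 'v) cohomology_data"
  assumes E: "cohomology_theory K E" and f: "continuous_map X euclideanreal f"
    and "tame K E X f" and p: "p \<in> strip_D"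
  shows "vectorspace.fin_dim K (sub_coh E X n (preim_rho X f p))"
proof -
  obtain x y where xy: "p = (x, y)" "y \<le> x" and strip: "p \<in> strip"
    using p by (auto simp: strip_D_def)
  have interval: "vectorspace.fin_dim K (sub_coh E X m (preim X f I, {}))"
    if "open I" "is_interval I" for m I
    using assms(3) that by (simp add: tame_def)
  have open_preim: "openin X (preim X f I)" if "open I" for I
    using f that unfolding preim_def continuous_map_def by auto
  have arctan_vimage: "open (arctan -` J) \<and> is_interval (arctan -` J)"
    if "open J" "is_interval J" for J
  proof
    have "continuous_on UNIV arctan"
      by (intro continuous_intros)
    with that(1) show "open (arctan -` J)"
      by (rule open_vimage)
    show "is_interval (arctan -` J)"
      using that(2) by (intro is_interval_vimage_mono monoI) (simp_all add: arctan_le_iff)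
  qed
  define L R where "L = arctan -` {..<y}" and "R = arctan -` {x<..}"
  have L: "open L \<and> is_interval L" and R: "open R \<and> is_interval R"
    unfolding L_def R_def by (intro arctan_vimage; simp)+
  have "preim X f (rho0 p) = preim X f L \<union> preim X f R"
    by (auto simp: preim_def xy rho0_def L_def R_def)
  moreover have "preim X f L \<inter> preim X f R = {}"
    using xy(2) by (auto simp: preim_def L_def R_def)
  ultimately have "vectorspace.fin_dim K (sub_coh E X (n - 1) (preim X f (rho0 p), {}))"
    using fin_dim_sub_coh_disjoint_union[OF E open_preim open_preim] interval L R by simp
  moreover have "vectorspace.fin_dim K (sub_coh E X n (preim X f (rho1 p), {}))"
  proof -
    have "rho1 p = arctan -` {- pi - y<..<pi - x}"
      by (auto simp: rho1_def xy(1))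
    then show ?thesis
      using interval arctan_vimage[of "{- pi - y<..<pi - x}"] by simp
  qed
  moreover have "preim X f (rho0 p) \<subseteq> preim X f (rho1 p)"
    using rho0_subset_rho1[OF strip] by (auto simp: preim_def)
  moreover have "preim X f (rho1 p) \<subseteq> topspace X"
    by (auto simp: preim_def)
  ultimately show ?thesis
    unfolding preim_rho_def by (simp add: fin_dim_sub_coh_pair[OF E])
qed

theorem lemma2p3:
  fixes K :: "('k, 'm) ring_scheme"
    and E :: "('a \<times> real, 'k, 'v) cohomology_data"
    and X :: "'a topology"
    and f :: "'a \<Rightarrow> real"
  assumes "cohomology_theory K E"
    and "continuous_map X euclideanreal f"
  shows "tame K E X f \<longleftrightarrow> pointwise_fin_dim K (h_functor E X f)"
proof
  assume "tame K E X f"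
  then show "pointwise_fin_dim K (h_functor E X f)"
    unfolding pointwise_fin_dim_h_functor_iff using assms fin_dim_preim_rho_if_tame by blast
next
  assume "pointwise_fin_dim K (h_functor E X f)"
  then have D: "vectorspace.fin_dim K (sub_coh E X n (preim_rho X f p))" if "p \<in> strip_D" for n p
    using that by (simp add: pointwise_fin_dim_h_functor_iff)
  have "vectorspace.fin_dim K (sub_coh E X n (preim X f I, {}))"
    if I: "open I" "is_interval I" for n I
  proof (cases "I = {}")
    case True
    then show ?thesis
      using fin_dim_sub_coh_empty[OF assms(1)] by (simp add: preim_def)
  next
    case False
    with I obtain p where "p \<in> strip_D" "rho1 p = I" "rho0 p = {}"
      using rho_of_open_interval by blast
    with D[of p n] show ?thesis
      by (simp add: preim_rho_def preim_def)
  qed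
  then show "tame K E X f"
    by (simp add: tame_def)
qed

end
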